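(* Let $p\ge1$ and $n\ge 2p$ be integers. For all $U,\widetilde U\in\mathrm{St}(n,p)$, $$d_{\mathrm E}(U,\widetilde U)\le\frac{\pi}{2}\|\widetilde U-U\|_{\mathrm F}.$$
   Context: The Stiefel manifold is $\mathrm{St}(n,p)=\{U\in\mathbb{R}^{n\times p} : U^TU=I_p\}$, and $\|\cdot\|_{\mathrm F}$ is the Frobenius norm. The Euclidean geodesic distance on $\mathrm{St}(n,p)$ (induced by the metric inherited from $\mathbb{R}^{n\times p}$ with the Frobenius inner product) is $d_{\mathrm E}(U,\widetilde U)=\inf_\gamma\int_0^1\|\dot\gamma(t)\|_{\mathrm F}\,dt$, the infimum being over continuously differentiable curves $\gamma:[0,1]\to\mathrm{St}(n,p)$ with $\gamma(0)=U$, $\gamma(1)=\widetilde U$. *)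

theory Defs
  imports "HOL-Analysis.Analysis"
begin

text \<open>
  Real \<open>n \<times> p\<close> matrices are elements of \<open>real ^ 'p ^ 'n\<close>, with \<open>n = CARD('n)\<close> and
  \<open>p = CARD('p)\<close> (rows are indexed by \<open>'n\<close>). Index types are nonempty, so \<open>p \<ge> 1\<close> holds
  automatically.
  The library norm on this type is the Frobenius norm:
\<close>

lemma norm_matrix_eq_Frobenius:
  fixes A :: "real ^ 'p ^ 'n"
  shows "norm A = sqrt (\<Sum>i\<in>UNIV. \<Sum>j\<in>UNIV. (A $ i $ j)\<^sup>2)"
  by (simp add: norm_vec_def L2_set_def sum_nonneg)

definition Stiefel :: "(real ^ 'p ^ 'n) set" where
  "Stiefel = {U. transpose U ** U = mat 1}"

text \<open>
  A curve on \<open>[0,1]\<close> is a total function of which only the values on \<open>{0..1}\<close> matter;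
  derivatives are taken within \<open>{0..1}\<close>, hence are one-sided at the endpoints.
\<close>

definition C1_curve :: "(real \<Rightarrow> 'a::real_normed_vector) \<Rightarrow> bool" where
  "C1_curve \<gamma> \<longleftrightarrow> \<gamma> differentiable_on {0..1} \<and>
     continuous_on {0..1} (\<lambda>t. vector_derivative \<gamma> (at t within {0..1}))"

definition curve_length :: "(real \<Rightarrow> 'a::real_normed_vector) \<Rightarrow> real" where
  "curve_length \<gamma> = integral {0..1} (\<lambda>t. norm (vector_derivative \<gamma> (at t within {0..1})))"

definition Stiefel_curves :: "real ^ 'p ^ 'n \<Rightarrow> real ^ 'p ^ 'n \<Rightarrow> (real \<Rightarrow> real ^ 'p ^ 'n) set" where
  "Stiefel_curves U V =
     {\<gamma>. C1_curve \<gamma> \<and> (\<forall>t\<in>{0..1}. \<gamma> t \<in> Stiefel) \<and> \<gamma> 0 = U \<and> \<gamma> 1 = V}"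

text \<open>
  The infimum is taken in the extended reals, so that it is \<open>\<infinity>\<close>, rather than an unspecified
  real number, when no admissible curve exists.
\<close>

definition dist_E :: "real ^ 'p ^ 'n \<Rightarrow> real ^ 'p ^ 'n \<Rightarrow> ereal" where
  "dist_E U V = (INF \<gamma>\<in>Stiefel_curves U V. ereal (curve_length \<gamma>))"

end

theory Submission imports Defs begin

text \<open>
  Since \<open>n > p\<close>, some rotation \<open>f\<close> of \<open>\<real>\<^sup>n\<close> with determinant 1 maps the columns of \<open>U\<close> to those of
  \<open>V\<close>. Decompose \<open>\<real>\<^sup>n\<close> into \<open>f\<close>-invariant orthogonal planes on which \<open>f\<close> rotates by an angle
  \<open>\<theta> \<in> [0, \<pi>]\<close> and lines fixed by \<open>f\<close>; the eigenvalue \<open>- 1\<close> has even multiplicity, so its lines pair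
  up into planes with \<open>\<theta> = \<pi>\<close>. Rotating each plane at constant speed \<open>\<theta>\<close> gives a path \<open>R t\<close> from the
  identity to \<open>f\<close>. On such a plane a vector \<open>x\<close> moves with speed \<open>\<theta> |x|\<close>, whereas
  \<open>|f x - x| = 2 sin (\<theta> / 2) |x| \<ge> (2 / \<pi>) \<theta> |x|\<close>; by orthogonality the speed of every \<open>x \<in> \<real>\<^sup>n\<close> is at
  most \<open>(\<pi> / 2) |f x - x|\<close>. Applied to the columns of \<open>U\<close> this bounds the Frobenius speed of
  \<open>t \<mapsto> R t U\<close>.
\<close>

subsection \<open>Rotations along orthogonal invariant subspaces\<close>

text \<open>By concavity the graph of \<open>sin\<close> lies above its chord from 0 to
  \<open>pi / 2\<close>. This inequality is the source of the constant \<open>pi / 2\<close>: at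
  half the rotation angle it compares the length of an arc with its chord.\<close>

lemma jordan_sin_ge:
  fixes x :: real
  assumes "0 \<le> x" "x \<le> pi / 2"
  shows "2 / pi * x \<le> sin x"
proof -
  have "concave_on {0..pi/2} sin"
  proof (rule f''_le0_imp_concave)
    show "(sin has_real_derivative cos t) (at t)" for t :: real
      by (auto intro!: derivative_eq_intros)
    show "(cos has_real_derivative - sin t) (at t)" for t :: real
      by (auto intro!: derivative_eq_intros)
    show "- sin t \<le> 0" if "t \<in> {0..pi/2}" for t :: real
      using that by (simp add: sin_ge_zero)
  qed auto
  from concave_onD_Icc'[OF this, of x] assms show ?thesis
    by (simp add: field_simps)
qed

text \<open>A C1 path of isometries of \<open>W\<close> from the identity to \<open>f\<close>. Both
  \<open>R\<close> and \<open>R'\<close> stay in \<open>W\<close>, so that motions on orthogonal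
  subspaces can be added, and the speed bound is pointwise in \<open>x\<close>, so that it applies
  to each column of a matrix.\<close>

definition short_motion :: "('a::euclidean_space \<Rightarrow> 'a) \<Rightarrow> 'a set \<Rightarrow> bool" where
  "short_motion f W \<longleftrightarrow> (\<exists>R R'. \<forall>t. \<forall>x\<in>W.
     R t x \<in> W \<and> R' t x \<in> W \<and> (\<forall>y\<in>W. R t x \<bullet> R t y = x \<bullet> y) \<and>
     R 0 x = x \<and> R 1 x = f x \<and>
     ((\<lambda>s. R s x) has_vector_derivative R' t x) (at t) \<and>
     continuous_on UNIV (\<lambda>s. R' s x) \<and>
     norm (R' t x) \<le> pi / 2 * norm (f x - x))"

lemma short_motion_fixed:
  assumes "subspace W" "\<And>x. x \<in> W \<Longrightarrow> f x = x"
  shows "short_motion f W"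
  unfolding short_motion_def
  by (rule exI[of _ "\<lambda>t x. x"], rule exI[of _ "\<lambda>t x. 0"])
     (use assms in \<open>auto simp: subspace_0\<close>)

text \<open>By Pythagoras the squared bounds add up on both sides, so gluing orthogonal pieces keeps
  the same constant \<open>k\<close>.\<close>

lemma norm_add_le_orthogonal:
  fixes a b c d :: "'a::real_inner"
  assumes "a \<bullet> b = 0" "c \<bullet> d = 0" "norm a \<le> k * norm c" "norm b \<le> k * norm d" "0 \<le> k"
  shows "norm (a + b) \<le> k * norm (c + d)"
proof (rule power2_le_imp_le)
  have "(norm (a + b))\<^sup>2 = (norm a)\<^sup>2 + (norm b)\<^sup>2"
    using assms(1) by (simp add: norm_add_Pythagorean orthogonal_def)
  also have "\<dots> \<le> (k * norm c)\<^sup>2 + (k * norm d)\<^sup>2"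
    using assms by (intro add_mono power_mono) auto
  also have "\<dots> = (k * norm (c + d))\<^sup>2"
    using assms(2) by (simp add: norm_add_Pythagorean orthogonal_def power_mult_distrib algebra_simps)
  finally show "(norm (a + b))\<^sup>2 \<le> (k * norm (c + d))\<^sup>2" .
qed (use assms in auto)

text \<open>The two components of a vector move independently. Mixed inner products vanish because
  each motion stays in its own subspace, and invariance of \<open>A\<close> and \<open>B\<close>
  splits the displacement \<open>f x - x\<close> orthogonally as well.\<close>

lemma short_motion_orthogonal_sum:
  assumes lin: "linear f" and "subspace A" "subspace B"
    and perp: "\<And>a b. a \<in> A \<Longrightarrow> b \<in> B \<Longrightarrow> a \<bullet> b = 0"
    and f: "f ` A \<subseteq> A" "f ` B \<subseteq> B"
    and gA: "short_motion f A" and gB: "short_motion f B"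
    and W: "W = {a + b | a b. a \<in> A \<and> b \<in> B}"
  shows "short_motion f W"
proof -
  obtain R R' where R: "\<And>t x. x \<in> A \<Longrightarrow>
     R t x \<in> A \<and> R' t x \<in> A \<and> (\<forall>y\<in>A. R t x \<bullet> R t y = x \<bullet> y) \<and>
     R 0 x = x \<and> R 1 x = f x \<and>
     ((\<lambda>s. R s x) has_vector_derivative R' t x) (at t) \<and>
     continuous_on UNIV (\<lambda>s. R' s x) \<and>
     norm (R' t x) \<le> pi / 2 * norm (f x - x)"
    using gA unfolding short_motion_def by blast
  obtain Q Q' where Q: "\<And>t x. x \<in> B \<Longrightarrow>
     Q t x \<in> B \<and> Q' t x \<in> B \<and> (\<forall>y\<in>B. Q t x \<bullet> Q t y = x \<bullet> y) \<and>
     Q 0 x = x \<and> Q 1 x = f x \<and>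
     ((\<lambda>s. Q s x) has_vector_derivative Q' t x) (at t) \<and>
     continuous_on UNIV (\<lambda>s. Q' s x) \<and>
     norm (Q' t x) \<le> pi / 2 * norm (f x - x)"
    using gB unfolding short_motion_def by blast
  have "\<forall>x\<in>W. \<exists>a b. a \<in> A \<and> b \<in> B \<and> x = a + b"
    using W by blast
  then obtain p q where pq: "\<And>x. x \<in> W \<Longrightarrow> p x \<in> A \<and> q x \<in> B \<and> x = p x + q x"
    by metis
  have sumW: "a + b \<in> W" if "a \<in> A" "b \<in> B" for a b
    using that W by blast
  have perp': "b \<bullet> a = 0" if "a \<in> A" "b \<in> B" for a b
    using perp[OF that] by (simp add: inner_commute)
  show ?thesis
    unfolding short_motion_def
  proof (rule exI[of _ "\<lambda>t x. R t (p x) + Q t (q x)"],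
         rule exI[of _ "\<lambda>t x. R' t (p x) + Q' t (q x)"], intro allI ballI conjI)
    fix t :: real and x assume x: "x \<in> W"
    note px = pq[OF x]
    have Rx: "\<And>t. R t (p x) \<in> A \<and> R' t (p x) \<in> A" and Qx: "\<And>t. Q t (q x) \<in> B \<and> Q' t (q x) \<in> B"
      using R Q px by blast+
    show "R t (p x) + Q t (q x) \<in> W" "R' t (p x) + Q' t (q x) \<in> W"
      using Rx Qx sumW by blast+
    show "R 0 (p x) + Q 0 (q x) = x"
      using R Q px by metis
    have "f x = f (p x) + f (q x)"
      using linear_add[OF lin, of "p x" "q x"] px by simp
    then show "R 1 (p x) + Q 1 (q x) = f x"
      using R Q px by metis
    show "((\<lambda>s. R s (p x) + Q s (q x)) has_vector_derivative R' t (p x) + Q' t (q x)) (at t)"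
      using R Q px by (intro has_vector_derivative_add) blast+
    show "continuous_on UNIV (\<lambda>s. R' s (p x) + Q' s (q x))"
      using R Q px by (intro continuous_on_add) blast+
    have eq: "f x - x = (f (p x) - p x) + (f (q x) - q x)"
      using \<open>f x = f (p x) + f (q x)\<close> px by (simp add: algebra_simps)
    show "norm (R' t (p x) + Q' t (q x)) \<le> pi / 2 * norm (f x - x)"
      unfolding eq
    proof (rule norm_add_le_orthogonal)
      show "R' t (p x) \<bullet> Q' t (q x) = 0"
        using Rx Qx perp by blast
      show "(f (p x) - p x) \<bullet> (f (q x) - q x) = 0"
        using px f assms(2,3) by (intro perp subspace_diff) auto
    qed (use R Q px in auto)
  next
    fix t :: real and x y assume x: "x \<in> W" and y: "y \<in> W"
    note px = pq[OF x] and py = pq[OF y]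
    have 1: "R t (p x) \<bullet> R t (p y) = p x \<bullet> p y" "Q t (q x) \<bullet> Q t (q y) = q x \<bullet> q y"
      using R Q px py by blast+
    have 2: "R t (p x) \<bullet> Q t (q y) = 0" "Q t (q x) \<bullet> R t (p y) = 0"
      using R Q px py by (blast intro: perp perp')+
    have 3: "p x \<bullet> q y = 0" "q x \<bullet> p y = 0"
      using px py by (blast intro: perp perp')+
    have "x \<bullet> y = (p x + q x) \<bullet> (p y + q y)"
      using px py by simp
    then show "(R t (p x) + Q t (q x)) \<bullet> (R t (p y) + Q t (q y)) = x \<bullet> y"
      by (simp add: inner_add 1 2 3)
  qed
qed

lemma span_pair_orthonormal:
  fixes u v :: "'a::real_inner"
  assumes uv: "norm u = 1" "norm v = 1" "u \<bullet> v = 0" and x: "x \<in> span {u, v}"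
  shows "x = (x \<bullet> u) *\<^sub>R u + (x \<bullet> v) *\<^sub>R v"
proof -
  obtain a b where "x = a *\<^sub>R u + b *\<^sub>R v"
    using x by (auto simp: span_insert algebra_simps)
  then show ?thesis
    using uv by (simp add: inner_add inner_commute norm_eq_1 inner_left_distrib)
qed

lemma short_motion_rotation:
  assumes lin: "linear f" and uv: "norm u = 1" "norm v = 1" "u \<bullet> v = 0"
    and \<theta>: "0 \<le> \<theta>" "\<theta> \<le> pi"
    and fu: "f u = cos \<theta> *\<^sub>R u + sin \<theta> *\<^sub>R v"
    and fv: "f v = - sin \<theta> *\<^sub>R u + cos \<theta> *\<^sub>R v"
  shows "short_motion f (span {u, v})"
proof -
  \<comment> \<open>\<open>C a b\<close> has coordinates \<open>a\<close>, \<open>b\<close> in the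
    orthonormal basis \<open>u\<close>, \<open>v\<close>. In these coordinates \<open>R t\<close>
    below is the rotation by \<open>t * \<theta>\<close> and \<open>R'\<close> its time
    derivative.\<close>
  define C where "C a b = a *\<^sub>R u + b *\<^sub>R v" for a b
  have C_in: "C a b \<in> span {u, v}" for a b
    unfolding C_def by (intro span_add span_scale span_base) auto
  have C_inner: "C a b \<bullet> C c d = a * c + b * d" for a b c d
    using uv by (simp add: C_def inner_add inner_commute norm_eq_1)
  define R where "R t x = C ((x \<bullet> u) * cos (t * \<theta>) - (x \<bullet> v) * sin (t * \<theta>))
                            ((x \<bullet> u) * sin (t * \<theta>) + (x \<bullet> v) * cos (t * \<theta>))" for t x
  define R' where "R' t x = C (- \<theta> * ((x \<bullet> u) * sin (t * \<theta>) + (x \<bullet> v) * cos (t * \<theta>)))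
                            (\<theta> * ((x \<bullet> u) * cos (t * \<theta>) - (x \<bullet> v) * sin (t * \<theta>)))" for t x
  have xC: "x = C (x \<bullet> u) (x \<bullet> v)" if "x \<in> span {u, v}" for x
    unfolding C_def by (rule span_pair_orthonormal[OF uv that])
  have fx: "f x = R 1 x" if "x \<in> span {u, v}" for x
  proof -
    have "f x = (x \<bullet> u) *\<^sub>R f u + (x \<bullet> v) *\<^sub>R f v"
      using arg_cong[OF xC[OF that], of f] lin by (simp add: C_def linear_add linear_scale)
    then show ?thesis
      by (simp add: fu fv R_def C_def algebra_simps)
  qed
  have sc: "sin r * sin r = 1 - cos r * cos r" for r :: real
    using sin_cos_squared_add[of r] by (simp add: power2_eq_square)
  show ?thesis
    unfolding short_motion_def
  proof (rule exI[of _ R], rule exI[of _ R'], intro allI ballI conjI)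
    fix t :: real and x assume x: "x \<in> span {u, v}"
    show "R t x \<in> span {u, v}" "R' t x \<in> span {u, v}"
      unfolding R_def R'_def by (rule C_in)+
    show "R 0 x = x"
      using xC[OF x] by (simp add: R_def)
    show "R 1 x = f x" by (simp add: fx x)
    show "((\<lambda>s. R s x) has_vector_derivative R' t x) (at t)"
      unfolding R_def R'_def C_def has_vector_derivative_def
      by (auto intro!: derivative_eq_intros simp: algebra_simps)
    show "continuous_on UNIV (\<lambda>s. R' s x)"
      unfolding R'_def C_def by (intro continuous_intros)
    let ?r = "(x \<bullet> u)\<^sup>2 + (x \<bullet> v)\<^sup>2"
    have nC: "(norm (C a b))\<^sup>2 = a\<^sup>2 + b\<^sup>2" for a b
      unfolding power2_norm_eq_inner C_inner by (simp add: power2_eq_square)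
    have "(norm (R' t x))\<^sup>2 = \<theta>\<^sup>2 * ?r"
      unfolding R'_def nC using sc[of "t * \<theta>"] by algebra
    moreover have nf: "(norm (f x - x))\<^sup>2 = (2 * sin (\<theta> / 2))\<^sup>2 * ?r"
    proof -
      have "f x - x = C ((x \<bullet> u) * (cos \<theta> - 1) - (x \<bullet> v) * sin \<theta>)
                        ((x \<bullet> u) * sin \<theta> + (x \<bullet> v) * (cos \<theta> - 1))"
        by (subst (2) xC[OF x]) (simp add: fx x R_def C_def algebra_simps)
      \<comment> \<open>With \<open>c\<close> and \<open>s\<close> the cosine and sine of \<theta>,
        this is the squared modulus of \<open>exp (i \<theta>) - 1\<close> times that of
        \<open>a + i b\<close>.\<close>
      moreover have "(a * (c - 1) - b * s)\<^sup>2 + (a * s + b * (c - 1))\<^sup>2 = (2 - 2 * c) * (a\<^sup>2 + b\<^sup>2)"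
        if "s * s = 1 - c * c" for a b c s :: real
        using that by algebra
      ultimately have "(norm (f x - x))\<^sup>2 = (2 - 2 * cos \<theta>) * ?r"
        using sc[of \<theta>] by (simp only: nC)
      also have "2 - 2 * cos \<theta> = (2 * sin (\<theta> / 2))\<^sup>2"
        using cos_double_sin[of "\<theta> / 2"] by (simp add: power2_eq_square)
      finally show ?thesis .
    qed
    moreover have "\<theta> \<le> pi / 2 * (2 * sin (\<theta> / 2))"
      using jordan_sin_ge[of "\<theta> / 2"] \<theta> by (simp add: field_simps)
    then have "\<theta>\<^sup>2 * ?r \<le> (pi / 2 * (2 * sin (\<theta> / 2)))\<^sup>2 * ?r"
      using \<theta> by (intro mult_right_mono power_mono) auto
    ultimately have "(norm (R' t x))\<^sup>2 \<le> (pi / 2 * norm (f x - x))\<^sup>2"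
      by (simp only: power_mult_distrib[of _ "norm _"] power_mult_distrib[of "pi / 2"] nf mult.assoc)
    then show "norm (R' t x) \<le> pi / 2 * norm (f x - x)"
      by (rule power2_le_imp_le) simp
  next
    fix t :: real and x y assume "x \<in> span {u, v}" and "y \<in> span {u, v}"
    then have "x \<bullet> y = (x \<bullet> u) * (y \<bullet> u) + (x \<bullet> v) * (y \<bullet> v)"
      using xC C_inner by metis
    then show "R t x \<bullet> R t y = x \<bullet> y"
      unfolding R_def C_inner using sc[of "t * \<theta>"] by algebra
  qed
qed


section \<open>Splitting off invariant subspaces of an orthogonal transformation\<close>

lemma orthogonal_transformation_complement_invariant:
  fixes f :: "'a::euclidean_space \<Rightarrow> 'a"
  assumes f: "orthogonal_transformation f" and A: "subspace A" "f ` A \<subseteq> A"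
    and b: "\<And>a. a \<in> A \<Longrightarrow> a \<bullet> b = 0" and a: "a \<in> A"
  shows "a \<bullet> f b = 0"
proof -
  have lin: "linear f" using f by (rule orthogonal_transformation_linear)
  have "dim (f ` A) = dim A"
    using orthogonal_transformation_inj[OF f] lin by (intro dim_image_eq) (auto intro: inj_on_subset)
  then have "f ` A = A"
    using A by (intro subspace_dim_equal linear_subspace_image[OF lin]) auto
  then obtain c where "c \<in> A" "a = f c" using a by blast
  then show ?thesis
    using f b by (simp add: orthogonal_transformation_def)
qed

lemma short_motion_orthogonal_extension:
  fixes f :: "'a::euclidean_space \<Rightarrow> 'a"
  assumes f: "orthogonal_transformation f" and W: "subspace W" "f ` W \<subseteq> W"
    and A: "subspace A" "A \<subseteq> W" "f ` A \<subseteq> A" "short_motion f A"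
    and B: "short_motion f (W \<inter> {b. \<forall>a\<in>A. a \<bullet> b = 0})"
  shows "short_motion f W"
proof (rule short_motion_orthogonal_sum[where A = A and B = "W \<inter> {b. \<forall>a\<in>A. a \<bullet> b = 0}"])
  let ?B = "W \<inter> {b. \<forall>a\<in>A. a \<bullet> b = 0}"
  show "linear f" using f by (rule orthogonal_transformation_linear)
  show "subspace ?B"
    using W(1) by (auto simp: subspace_def inner_right_distrib)
  show "f ` ?B \<subseteq> ?B"
    using W orthogonal_transformation_complement_invariant[OF f A(1,3)] by auto
  \<comment> \<open>Orthogonal projection onto \<open>A\<close>; the remainder stays in
    \<open>W\<close> because \<open>A \<subseteq> W\<close>.\<close>
  have "\<exists>a b. x = a + b \<and> a \<in> A \<and> b \<in> ?B" if "x \<in> W" for x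
  proof -
    obtain y z where yz: "y \<in> span A" "\<And>w. w \<in> span A \<Longrightarrow> orthogonal z w" "x = y + z"
      using orthogonal_subspace_decomp_exists[of A x] by blast
    have sA: "span A = A" using A(1) by (simp add: span_eq_iff)
    have "z = x - y" using yz by simp
    then have "z \<in> W" using that yz(1) A W(1) unfolding sA by (auto intro: subspace_diff)
    then show ?thesis
      using yz unfolding sA by (intro exI[of _ y] exI[of _ z]) (auto simp: orthogonal_def inner_commute)
  qed
  moreover have "a + b \<in> W" if "a \<in> A" "b \<in> ?B" for a b
    using that A W(1) by (auto intro: subspace_add)
  ultimately show "W = {a + b |a b. a \<in> A \<and> b \<in> ?B}"
    by blast
qed (use A B in auto)

lemma ball_span_inner_eq_0_iff:
  fixes b :: "'a::euclidean_space"
  shows "(\<forall>a\<in>span S. a \<bullet> b = 0) \<longleftrightarrow> (\<forall>a\<in>S. a \<bullet> b = 0)"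
proof
  assume "\<forall>a\<in>S. a \<bullet> b = 0"
  then show "\<forall>a\<in>span S. a \<bullet> b = 0"
    by (auto simp: inner_commute[of _ b] simp flip: orthogonal_def intro: orthogonal_to_span)
qed (simp add: span_base)

text \<open>The first-order condition at a maximum: for a small \<open>t\<close> with the sign of
  \<open>b\<close>, the linear term dominates.\<close>

lemma linear_coeff_zero_if_quadratic_nonpos:
  fixes b c :: real
  assumes "\<And>t. t * b + t\<^sup>2 * c \<le> 0"
  shows "b = 0"
proof -
  \<comment> \<open>At \<open>t = b / d\<close> the quadratic equals
    \<open>b\<^sup>2 * (d + c) / d\<^sup>2\<close>, where \<open>d + c \<ge> 1\<close>; hence it can
    be nonpositive only for \<open>b = 0\<close>.\<close>
  define d where "d = 1 + \<bar>c\<bar>"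
  have d: "d > 0" "d + c \<ge> 1" unfolding d_def by auto
  have "(b / d) * b + (b / d)\<^sup>2 * c = b\<^sup>2 * (d + c) / d\<^sup>2"
    using d by (simp add: field_simps power2_eq_square)
  then have "b\<^sup>2 * (d + c) \<le> 0"
    using assms[of "b / d"] d by (simp add: divide_le_0_iff)
  then show ?thesis
    using d by (auto simp: mult_le_0_iff)
qed

text \<open>
  A maximiser \<open>x\<close> of \<open>y \<bullet> f y\<close> on the unit sphere of \<open>W\<close> is an eigenvector of the symmetric part
  of \<open>f\<close>; as the adjoint of \<open>f\<close> is its inverse, this makes \<open>span {x, f x}\<close> invariant.
\<close>

lemma orthogonal_transformation_invariant_pair:
  fixes f :: "'a::euclidean_space \<Rightarrow> 'a"
  assumes f: "orthogonal_transformation f" and W: "subspace W" "f ` W \<subseteq> W" "W \<noteq> {0}"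
  obtains x where "x \<in> W" "norm x = 1" "f (f x) = (2 * (x \<bullet> f x)) *\<^sub>R f x - x"
proof -
  have lin: "linear f" using f by (rule orthogonal_transformation_linear)
  have ff: "f v \<bullet> f w = v \<bullet> w" for v w using f by (simp add: orthogonal_transformation_def)
  let ?S = "sphere 0 1 \<inter> W"
  obtain w where w: "w \<in> W" "w \<noteq> 0" using W(1,3) subspace_0 by blast
  then have "w /\<^sub>R norm w \<in> ?S" using W(1) by (auto intro: subspace_scale)
  then have "?S \<noteq> {}" by blast
  moreover have "compact ?S"
    using W(1) by (intro compact_Int_closed compact_sphere closed_subspace)
  moreover have "continuous_on ?S (\<lambda>y. y \<bullet> f y)"
    using lin by (intro continuous_intros linear_continuous_on) (simp add: linear_conv_bounded_linear)
  ultimately obtain x where x: "x \<in> ?S" and max: "\<And>y. y \<in> ?S \<Longrightarrow> y \<bullet> f y \<le> x \<bullet> f x"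
    using continuous_attains_sup[of ?S "\<lambda>y. y \<bullet> f y"] by blast
  define l where "l = x \<bullet> f x"
  have xx: "x \<bullet> x = 1" using x by (simp add: norm_eq_1)
  \<comment> \<open>Maximality on the unit sphere extends to all of \<open>W\<close>, since both
    sides are homogeneous of degree 2.\<close>
  have bound: "y \<bullet> f y \<le> l * (y \<bullet> y)" if "y \<in> W" for y
  proof (cases "y = 0")
    case False
    then have "y /\<^sub>R norm y \<in> ?S" using that W(1) by (auto intro: subspace_scale)
    from max[OF this] have "(y \<bullet> f y) / (norm y)\<^sup>2 \<le> l"
      using lin by (simp add: linear_scale l_def power2_eq_square divide_inverse mult_ac)
    then show ?thesis
      using False by (simp add: field_simps power2_norm_eq_inner)
  qed (use lin in \<open>simp add: linear_0\<close>)
  \<comment> \<open>Expanding \<open>bound\<close> at \<open>x + t *\<^sub>R y\<close> gives a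
    quadratic in \<open>t\<close> without constant term; its linear coefficient must vanish.\<close>
  have crit: "x \<bullet> f y + y \<bullet> f x = 2 * l * (x \<bullet> y)" if "y \<in> W" for y
  proof -
    have "t * (x \<bullet> f y + y \<bullet> f x - 2 * l * (x \<bullet> y)) + t\<^sup>2 * (y \<bullet> f y - l * (y \<bullet> y)) \<le> 0" for t
    proof -
      have "x + t *\<^sub>R y \<in> W" using x that W(1) by (auto intro: subspace_add subspace_scale)
      from bound[OF this] show ?thesis
        using lin xx
        by (simp add: linear_add linear_scale inner_add l_def[symmetric] inner_commute[of y x]
            algebra_simps power2_eq_square)
    qed
    from linear_coeff_zero_if_quadratic_nonpos[OF this] show ?thesis by simp
  qed
  \<comment> \<open>The case \<open>y = f x\<close> supplies the last unknown inner product among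
    \<open>x\<close>, \<open>f x\<close> and \<open>f (f x)\<close>; the claimed relation then
    follows because the difference of its sides has norm 0.\<close>
  have "x \<bullet> f (f x) + 1 = 2 * l * l"
    using crit[of "f x"] x W(2) ff[of x x] xx by (auto simp: l_def)
  moreover have "f (f x) \<bullet> f x = l" "f (f x) \<bullet> f (f x) = 1" "f x \<bullet> f x = 1" "x \<bullet> f x = l" "f x \<bullet> x = l"
    using ff xx by (simp_all add: l_def inner_commute)
  ultimately have "(norm (f (f x) - ((2 * l) *\<^sub>R f x - x)))\<^sup>2 = 0"
    using xx inner_commute[of "f (f x)" x] inner_commute[of "f (f x)" "f x"]
    unfolding power2_norm_eq_inner by (simp add: inner_diff algebra_simps)
  then have "f (f x) = (2 * l) *\<^sub>R f x - x" by simp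
  then show thesis using that x unfolding l_def by auto
qed

text \<open>Induction on the dimension, splitting off a fixed line, a rotation plane or a line on
  which \<open>f\<close> is \<open>- 1\<close>. Lines of the last kind are paired into planes turned
  by \<open>pi\<close>; the second alternative records one line \<open>e\<close> left without a
  partner.\<close>

lemma short_motion_or_odd:
  fixes f :: "'a::euclidean_space \<Rightarrow> 'a"
  assumes f: "orthogonal_transformation f" and "subspace W" "f ` W \<subseteq> W"
  shows "short_motion f W \<or>
         (\<exists>e\<in>W. norm e = 1 \<and> f e = - e \<and> short_motion f (W \<inter> {x. e \<bullet> x = 0}))"
  using assms(2,3)
proof (induction "dim W" arbitrary: W rule: less_induct)
  case less
  note W = less.prems
  have lin: "linear f" using f by (rule orthogonal_transformation_linear)
  have ff: "f v \<bullet> f w = v \<bullet> w" for v w using f by (simp add: orthogonal_transformation_def)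
  let ?odd = "\<lambda>e W. norm e = 1 \<and> f e = - e \<and> short_motion f (W \<inter> {x. e \<bullet> x = 0})"
  show ?case
  proof (cases "W = {0}")
    case True
    then show ?thesis using lin by (auto intro!: short_motion_fixed simp: linear_0)
  next
    case False
    obtain x where x: "x \<in> W" "norm x = 1" and ffx: "f (f x) = (2 * (x \<bullet> f x)) *\<^sub>R f x - x"
      using orthogonal_transformation_invariant_pair[OF f W False] .
    define l where "l = x \<bullet> f x"
    have fxx: "f x \<in> W" "norm (f x) = 1" "x \<bullet> x = 1" "f x \<bullet> f x = 1"
      using x W f ff[of x x] by (auto simp: norm_eq_1)
    \<comment> \<open>The orthogonal complement of \<open>A\<close> inside \<open>W\<close>. It is
      smaller than \<open>W\<close> whenever \<open>x\<close> lies in \<open>A\<close>, which drives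
      the induction.\<close>
    define comp where "comp A = W \<inter> {b. \<forall>a\<in>A. a \<bullet> b = 0}" for A
    have comp: "subspace (comp A)" "f ` comp A \<subseteq> comp A" "dim (comp A) < dim W"
      if A: "subspace A" "f ` A \<subseteq> A" "x \<in> A" for A
    proof -
      show s: "subspace (comp A)"
        using W(1) by (auto simp: comp_def subspace_def inner_right_distrib)
      show "f ` comp A \<subseteq> comp A"
        using W orthogonal_transformation_complement_invariant[OF f A(1,2)] by (auto simp: comp_def)
      have "x \<notin> comp A" using A(3) fxx by (auto simp: comp_def intro: bexI[of _ x])
      then have "comp A \<subset> W" using x(1) by (auto simp: comp_def)
      then show "dim (comp A) < dim W"
        using s W(1) by (metis dim_subset psubset_eq subspace_dim_equal linorder_not_less)
    qed
    note IH = less.hyps[OF comp(3) comp(1) comp(2)]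
    have inv_pair: "f ` span {u, v} \<subseteq> span {u, v}"
      if "f u \<in> span {u, v}" "f v \<in> span {u, v}" for u v
      using that by (simp add: linear_span_image[OF lin, symmetric] span_minimal)
    \<comment> \<open>If \<open>A\<close> already carries a motion, either alternative passes from
      \<open>comp A\<close> to \<open>W\<close>. In the odd case \<open>e\<close> is orthogonal to
      \<open>A\<close>, so the gluing takes place inside the hyperplane orthogonal to
      \<open>e\<close>.\<close>
    have good: ?thesis
      if A: "subspace A" "A \<subseteq> W" "f ` A \<subseteq> A" "x \<in> A" "short_motion f A" for A
      using IH[OF A(1,3,4) A(1,3,4) A(1,3,4)]
    proof
      assume "short_motion f (comp A)"
      then have "short_motion f W"
        unfolding comp_def by (rule short_motion_orthogonal_extension[OF f W A(1-3,5)])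
      then show ?thesis ..
    next
      assume "\<exists>e\<in>comp A. ?odd e (comp A)"
      then obtain e where e: "e \<in> comp A" "norm e = 1" "f e = - e"
        and B: "short_motion f (comp A \<inter> {x. e \<bullet> x = 0})" by blast
      let ?W = "W \<inter> {x. e \<bullet> x = 0}"
      have "short_motion f ?W"
      proof (rule short_motion_orthogonal_extension[OF f _ _ A(1) _ A(3,5)])
        show "subspace ?W" using W(1) by (auto simp: subspace_def inner_right_distrib)
        have "e \<bullet> f z = - (e \<bullet> z)" for z using ff[of e z] e(3) by (simp add: inner_minus_left)
        then show "f ` ?W \<subseteq> ?W" using W(2) by auto
        show "A \<subseteq> ?W" using A(2) e(1) by (auto simp: comp_def inner_commute)
        have "?W \<inter> {b. \<forall>a\<in>A. a \<bullet> b = 0} = comp A \<inter> {x. e \<bullet> x = 0}"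
          by (auto simp: comp_def)
        with B show "short_motion f (?W \<inter> {b. \<forall>a\<in>A. a \<bullet> b = 0})" by simp
      qed
      then show ?thesis using e by (auto simp: comp_def)
    qed
    \<comment> \<open>The values \<open>c = 1\<close> and \<open>c = - 1\<close> give
      \<open>- 1 \<le> l \<le> 1\<close>, with \<open>f x = x\<close> or \<open>f x = - x\<close> at
      the ends; \<open>c = l\<close> measures the part of \<open>f x\<close> orthogonal to
      \<open>x\<close>.\<close>
    have dist2: "(norm (f x - c *\<^sub>R x))\<^sup>2 = 1 + c * c - 2 * c * l" for c
      using fxx unfolding power2_norm_eq_inner
      by (simp add: inner_diff l_def inner_commute[of "f x" x] algebra_simps)
    consider "l = 1" | "l = -1" | "-1 < l" "l < 1"
      using dist2[of 1, symmetric] dist2[of "-1", symmetric]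
        zero_le_power2[of "norm (f x - 1 *\<^sub>R x)"] zero_le_power2[of "norm (f x - (- 1) *\<^sub>R x)"]
      by linarith
    then show ?thesis
    proof cases
      case 1
      then have "f x = x" using dist2[of 1] by simp
      then have "f z = z" if "z \<in> span {x}" for z
        using that lin by (auto simp: span_singleton linear_scale)
      then show ?thesis
        using x W(1) by (intro good[of "span {x}"] short_motion_fixed)
          (auto simp: span_base intro: span_minimal[THEN subsetD])
    next
      case 2
      then have "f x + x = 0" using dist2[of "-1"] by simp
      then have fx: "f x = - x" by (simp add: eq_neg_iff_add_eq_0)
      have A: "subspace (span {x})" "f ` span {x} \<subseteq> span {x}" "x \<in> span {x}"
        using inv_pair[of x x] fx by (auto simp: span_base span_neg)
      have comp_eq: "comp (span {x}) = W \<inter> {z. x \<bullet> z = 0}"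
        by (simp add: comp_def ball_span_inner_eq_0_iff)
      from IH[OF A A A] show ?thesis
      proof
        \<comment> \<open>No line is left over in the complement, so \<open>x\<close> itself becomes
          the unpaired one.\<close>
        assume "short_motion f (comp (span {x}))"
        then show ?thesis using x fx comp_eq by auto
      next
        assume "\<exists>e\<in>comp (span {x}). ?odd e (comp (span {x}))"
        then obtain e where e: "e \<in> W" "x \<bullet> e = 0" "norm e = 1" "f e = - e"
          and B: "short_motion f (W \<inter> {z. x \<bullet> z = 0} \<inter> {z. e \<bullet> z = 0})"
          unfolding comp_eq by blast
        \<comment> \<open>The leftover \<open>e\<close> of the complement pairs with
          \<open>x\<close>: on their plane \<open>f\<close> is the half turn.\<close>
        have "short_motion f W"
        proof (rule short_motion_orthogonal_extension[OF f W])
          show "span {x, e} \<subseteq> W" using x e W(1) by (intro span_minimal) auto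
          show "f ` span {x, e} \<subseteq> span {x, e}"
            using fx e by (intro inv_pair) (auto simp: span_base span_neg)
          show "short_motion f (span {x, e})"
            using x e fx lin by (intro short_motion_rotation[where \<theta> = pi]) auto
          have "W \<inter> {b. \<forall>a\<in>span {x, e}. a \<bullet> b = 0} = W \<inter> {z. x \<bullet> z = 0} \<inter> {z. e \<bullet> z = 0}"
            by (auto simp: ball_span_inner_eq_0_iff)
          with B show "short_motion f (W \<inter> {b. \<forall>a\<in>span {x, e}. a \<bullet> b = 0})" by simp
        qed simp
        then show ?thesis ..
      qed
    next
      case 3
      define \<theta> where "\<theta> = arccos l"
      have \<theta>: "0 \<le> \<theta>" "\<theta> \<le> pi" "cos \<theta> = l" "0 < sin \<theta>"
        using 3 arccos_lt_bounded[of l] by (auto simp: \<theta>_def arccos_lbound arccos_ubound intro: sin_gt_zero)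
      have sc: "sin \<theta> * sin \<theta> = 1 - l * l"
        using sin_cos_squared_add[of \<theta>] \<theta> by (simp add: power2_eq_square)
      \<comment> \<open>Gram-Schmidt on \<open>x\<close>, \<open>f x\<close>. The orientation chosen
        by \<open>v\<close> makes the angle lie in \<open>[0, pi]\<close>, and the relation for
        \<open>f (f x)\<close> forces \<open>f v\<close> to be the second column of the
        rotation.\<close>
      define v where "v = (f x - l *\<^sub>R x) /\<^sub>R sin \<theta>"
      have fx: "f x = l *\<^sub>R x + sin \<theta> *\<^sub>R v" using \<theta> by (simp add: v_def)
      have "f v = (f (f x) - l *\<^sub>R f x) /\<^sub>R sin \<theta>"
        using lin by (simp add: v_def linear_scale linear_diff)
      also have "\<dots> = (l *\<^sub>R f x - x) /\<^sub>R sin \<theta>"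
        unfolding ffx l_def[symmetric] by (simp add: algebra_simps flip: scaleR_add_left)
      also have "l *\<^sub>R f x - x = (- (sin \<theta> * sin \<theta>)) *\<^sub>R x + (l * sin \<theta>) *\<^sub>R v"
        unfolding sc fx by (simp add: algebra_simps)
      also have "\<dots> /\<^sub>R sin \<theta> = - sin \<theta> *\<^sub>R x + l *\<^sub>R v"
        using \<theta>(4) by (simp add: scaleR_diff_right field_simps)
      finally have fv: "f v = - sin \<theta> *\<^sub>R x + l *\<^sub>R v" .
      have xv: "x \<bullet> v = 0"
        using fxx by (simp add: v_def inner_diff l_def)
      have "(norm (f x - l *\<^sub>R x))\<^sup>2 = (sin \<theta>)\<^sup>2"
        unfolding dist2 power2_eq_square[of "sin \<theta>"] sc by simp
      then have "norm (f x - l *\<^sub>R x) = sin \<theta>"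
        using \<theta>(4) by (simp add: power2_eq_iff_nonneg)
      then have nv: "norm v = 1" using \<theta>(4) by (simp add: v_def)
      have "v \<in> W" using x fxx W(1) by (simp add: v_def subspace_scale subspace_diff)
      show ?thesis
      proof (rule good[of "span {x, v}"])
        show "span {x, v} \<subseteq> W" using x \<open>v \<in> W\<close> W(1) by (intro span_minimal) auto
        show "f ` span {x, v} \<subseteq> span {x, v}"
          unfolding fx fv by (intro inv_pair; unfold fx fv; intro span_add span_scale span_base) auto
        show "short_motion f (span {x, v})"
          using \<theta> x nv xv fx fv lin by (intro short_motion_rotation) auto
      qed (auto simp: span_base)
    qed
  qed
qed

subsection \<open>Parity of the eigenvalue \<open>- 1\<close>\<close>

text \<open>Supplies linearity: inner products determine distances, and an isometry fixing 0 is
  linear.\<close>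

lemma inner_preserving_imp_orthogonal_transformation:
  fixes g :: "real^'n \<Rightarrow> real^'n"
  assumes "\<And>x y. g x \<bullet> g y = x \<bullet> y"
  shows "orthogonal_transformation g"
proof -
  have "(dist (g x) (g y))\<^sup>2 = (dist x y)\<^sup>2" for x y
    unfolding dist_norm power2_norm_eq_inner by (simp add: inner_diff assms)
  then have "dist (g x) (g y) = dist x y" for x y
    by (metis power2_eq_iff_nonneg zero_le_dist)
  moreover have "g 0 = 0"
    using assms[of 0 0] by simp
  ultimately show ?thesis
    by (simp add: orthogonal_transformation_isometry)
qed

lemma continuous_on_det:
  fixes A :: "'a::topological_space \<Rightarrow> real^'n^'n"
  assumes "\<And>i j. continuous_on S (\<lambda>t. A t $ i $ j)"
  shows "continuous_on S (\<lambda>t. det (A t))"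
  unfolding det_def by (intro continuous_intros assms)

text \<open>The Householder formula, which describes a reflection for unit \<open>e\<close>.\<close>

definition hyperplane_reflection :: "'a::real_inner \<Rightarrow> 'a \<Rightarrow> 'a" where
  "hyperplane_reflection e x = x - (2 * (e \<bullet> x)) *\<^sub>R e"

lemma orthogonal_transformation_hyperplane_reflection:
  assumes "norm e = 1"
  shows "orthogonal_transformation (hyperplane_reflection e)"
  unfolding orthogonal_transformation_def
proof
  show "linear (hyperplane_reflection e)"
    by (rule linearI) (auto simp: hyperplane_reflection_def inner_right_distrib algebra_simps)
  show "\<forall>v w. hyperplane_reflection e v \<bullet> hyperplane_reflection e w = v \<bullet> w"
    using assms by (simp add: hyperplane_reflection_def inner_diff norm_eq_1 inner_commute)
qed

text \<open>Conjugating by an orthogonal \<open>T\<close> that sends a coordinate axis to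
  \<open>e\<close> makes the matrix diagonal with a single entry \<open>- 1\<close>.\<close>

lemma det_hyperplane_reflection:
  fixes e :: "real^'n"
  assumes e: "norm e = 1"
  shows "det (matrix (hyperplane_reflection e)) = -1"
proof -
  obtain k :: 'n where True by simp
  let ?k = "axis k 1 :: real^'n"
  let ?r = hyperplane_reflection
  obtain T where T: "orthogonal_transformation T" "T ?k = e"
    using orthogonal_transformation_exists[of ?k e] e by (metis norm_axis_1)
  have lin: "linear T" "linear (?r e)" "linear (?r ?k)"
    using T e orthogonal_transformation_linear orthogonal_transformation_hyperplane_reflection
      norm_axis_1 by blast+
  have "?r e \<circ> T = T \<circ> ?r ?k"
  proof
    fix x
    have "e \<bullet> T x = ?k \<bullet> x"
      using T by (auto simp: orthogonal_transformation_def)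
    then show "(?r e \<circ> T) x = (T \<circ> ?r ?k) x"
      using T lin by (simp add: hyperplane_reflection_def linear_diff linear_scale)
  qed
  then have "matrix (?r e) ** matrix T = matrix T ** matrix (?r ?k)"
    using matrix_compose lin by metis
  then have "det (matrix (?r e)) * det (matrix T) = det (matrix T) * det (matrix (?r ?k))"
    by (metis det_mul)
  moreover have "det (matrix T) \<noteq> 0"
    using orthogonal_transformation_det[OF T(1)] by auto
  moreover have "matrix (?r ?k) $ i $ j = (if i = j then if i = k then -1 else 1 else 0)" for i j
    by (simp add: matrix_def hyperplane_reflection_def inner_axis_axis) (simp add: axis_def)
  then have "det (matrix (?r ?k)) = -1"
    by (subst det_diagonal) auto
  ultimately have "det (matrix (?r e)) * det (matrix T) = (-1) * det (matrix T)"
    by simp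
  with \<open>det (matrix T) \<noteq> 0\<close> show ?thesis
    using mult_right_cancel by blast
qed

text \<open>
  Extending the motion by \<open>e \<mapsto> - e\<close> gives a path of orthogonal transformations from a reflection
  to \<open>f\<close>, along which the determinant cannot change.
\<close>

lemma det_short_motion_odd:
  fixes f :: "real^'n \<Rightarrow> real^'n"
  assumes f: "orthogonal_transformation f" and e: "norm e = 1" "f e = - e"
    and motion: "short_motion f {x. e \<bullet> x = 0}"
  shows "det (matrix f) = -1"
proof -
  let ?W = "{x. e \<bullet> x = 0}"
  obtain R R' where R: "\<And>t x. x \<in> ?W \<Longrightarrow>
     R t x \<in> ?W \<and> R' t x \<in> ?W \<and> (\<forall>y\<in>?W. R t x \<bullet> R t y = x \<bullet> y) \<and>
     R 0 x = x \<and> R 1 x = f x \<and>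
     ((\<lambda>s. R s x) has_vector_derivative R' t x) (at t) \<and>
     continuous_on UNIV (\<lambda>s. R' s x) \<and>
     norm (R' t x) \<le> pi / 2 * norm (f x - x)"
    using motion unfolding short_motion_def by blast
  define p where "p x = x - (e \<bullet> x) *\<^sub>R e" for x
  have ee: "e \<bullet> e = 1" using e by (simp add: norm_eq_1)
  have pW: "p x \<in> ?W" for x by (simp add: p_def inner_diff_right ee)
  \<comment> \<open>\<open>G t\<close> acts as \<open>R t\<close> on the hyperplane and as
    \<open>- 1\<close> on the line of \<open>e\<close>. Thus \<open>G 0\<close> is the reflection
    and \<open>G 1\<close> is \<open>f\<close>.\<close>
  define G where "G t x = R t (p x) - (e \<bullet> x) *\<^sub>R e" for t x
  have "G t x \<bullet> G t y = x \<bullet> y" for t x y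
  proof -
    have "e \<bullet> R t (p x) = 0" "e \<bullet> R t (p y) = 0" "R t (p x) \<bullet> R t (p y) = p x \<bullet> p y"
      using R[OF pW] pW by blast+
    moreover from this have "R t (p x) \<bullet> e = 0"
      by (simp add: inner_commute)
    moreover have "p x \<bullet> p y = x \<bullet> y - (e \<bullet> x) * (e \<bullet> y)"
      by (simp add: p_def inner_diff ee inner_commute)
    ultimately show ?thesis
      by (simp add: G_def inner_diff ee)
  qed
  then have orth: "orthogonal_transformation (G t)" for t
    by (rule inner_preserving_imp_orthogonal_transformation)
  define d where "d t = det (matrix (G t))" for t
  have d: "d t = 1 \<or> d t = -1" for t
    using orthogonal_transformation_det[OF orth[of t]] by (auto simp: d_def abs_if split: if_splits)
  have "continuous_on UNIV (\<lambda>t. R t (p x))" for x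
    using R[OF pW[of x]] by (intro continuous_at_imp_continuous_on ballI)
      (blast intro: has_vector_derivative_continuous)
  then have "continuous_on UNIV (\<lambda>t. G t x)" for x
    unfolding G_def by (intro continuous_on_diff continuous_on_const)
  then have "continuous_on UNIV (\<lambda>t. matrix (G t) $ i $ j)" for i j
    unfolding matrix_def by (simp add: continuous_on_component)
  then have cont: "continuous_on UNIV d"
    unfolding d_def by (rule continuous_on_det)
  have "G 0 x = hyperplane_reflection e x" for x
  proof -
    have "R 0 (p x) = p x" using R[OF pW[of x]] by blast
    then have "G 0 x = p x - (e \<bullet> x) *\<^sub>R e" by (simp add: G_def)
    moreover have "(2 * (e \<bullet> x)) *\<^sub>R e = (e \<bullet> x) *\<^sub>R e + (e \<bullet> x) *\<^sub>R e"
      by (simp flip: scaleR_left_distrib)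
    ultimately show ?thesis
      by (simp add: p_def hyperplane_reflection_def)
  qed
  then have "G 0 = hyperplane_reflection e" by blast
  then have d0: "d 0 = -1" using e by (simp add: d_def det_hyperplane_reflection)
  have "G 1 x = f x" for x
  proof -
    have lin: "linear f" using f by (rule orthogonal_transformation_linear)
    have "f (p x) = f x + (e \<bullet> x) *\<^sub>R e"
      using lin e by (simp add: p_def linear_diff linear_scale)
    moreover have "R 1 (p x) = f (p x)" using R[OF pW[of x]] by blast
    ultimately show ?thesis by (simp add: G_def)
  qed
  then have "G 1 = f" by blast
  then have "d 1 = det (matrix f)" by (simp add: d_def)
  moreover have "d 1 = -1"
  proof (rule ccontr)
    assume "d 1 \<noteq> -1"
    then have "d 1 = 1" using d by blast
    then have "\<exists>t\<ge>0. t \<le> 1 \<and> d t = 0"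
      using d0 by (intro IVT') (auto intro: continuous_on_subset[OF cont])
    then show False using d by (metis zero_neq_neg_one zero_neq_one)
  qed
  ultimately show ?thesis by simp
qed

text \<open>An unpaired eigenvector for \<open>- 1\<close> would force determinant
  \<open>- 1\<close>, so only the first alternative of the decomposition survives.\<close>

lemma short_motion_UNIV:
  fixes f :: "real^'n \<Rightarrow> real^'n"
  assumes f: "orthogonal_transformation f" and "det (matrix f) = 1"
  shows "short_motion f UNIV"
proof (rule ccontr)
  assume "\<not> ?thesis"
  then obtain e where "norm e = 1" "f e = - e" "short_motion f {x. e \<bullet> x = 0}"
    using short_motion_or_odd[OF f subspace_UNIV subset_UNIV] unfolding Int_UNIV_left by blast
  then have "det (matrix f) = -1"
    by (rule det_short_motion_odd[OF f])
  then show False using assms(2) by simp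
qed

subsection \<open>Points and curves on the Stiefel manifold\<close>

lemma Stiefel_inner:
  fixes U :: "real^'p^'n"
  assumes "U \<in> Stiefel"
  shows "(U *v x) \<bullet> (U *v y) = x \<bullet> y"
proof -
  have "(U *v x) \<bullet> (U *v y) = x \<bullet> (transpose U *v (U *v y))"
    by (metis dot_lmul_matrix transpose_matrix_vector transpose_transpose)
  also have "transpose U *v (U *v y) = y"
    using assms by (simp add: Stiefel_def matrix_vector_mul_assoc)
  finally show ?thesis .
qed

text \<open>\<open>U\<close> acts isometrically, hence injectively, so its range has dimension
  \<open>p\<close>. The complement therefore has the same dimension for every Stiefel matrix and is
  nonzero when \<open>p < n\<close>.\<close>

lemma dim_Stiefel_complement:
  fixes U :: "real^'p^'n"
  assumes "U \<in> Stiefel"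
  shows "dim {y. \<forall>x\<in>range ((*v) U). orthogonal x y} + CARD('p) = CARD('n)"
proof -
  have "inj ((*v) U)"
  proof (rule injI)
    fix x y assume "U *v x = U *v y"
    then have "(x - y) \<bullet> (x - y) = 0"
      using Stiefel_inner[OF assms, of "x - y" "x - y"] by (simp add: matrix_vector_mult_diff_distrib)
    then show "x = y" by simp
  qed
  then have "dim (range ((*v) U)) = CARD('p)"
    by (subst dim_image_eq) (auto intro: inj_on_subset)
  moreover have "subspace (range ((*v) U))"
    by (intro linear_subspace_image) auto
  ultimately show ?thesis
    using dim_subspace_orthogonal_to_vectors[of "range ((*v) U)" UNIV] by simp
qed

text \<open>On the range of \<open>U\<close> the map is \<open>V\<close> times the transpose of
  \<open>U\<close>; on the complement it is any linear isometry onto the complement of the range of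
  \<open>V\<close>.\<close>

lemma Stiefel_orthogonal_transformation_exists:
  fixes U V :: "real^'p^'n"
  assumes U: "U \<in> Stiefel" and V: "V \<in> Stiefel"
  obtains f where "orthogonal_transformation f" "\<And>x. f (U *v x) = V *v x"
proof -
  let ?C = "\<lambda>U::real^'p^'n. {y. \<forall>x\<in>range ((*v) U). orthogonal x y}"
  have sub: "subspace (?C U)" for U
    by (auto simp: subspace_def orthogonal_def inner_right_distrib)
  have "dim (?C U) = dim (?C V)"
    using dim_Stiefel_complement[OF U] dim_Stiefel_complement[OF V] by linarith
  then obtain g where g: "linear g" "g ` ?C U = ?C V" "\<And>x. x \<in> ?C U \<Longrightarrow> norm (g x) = norm x"
    using isometry_subspaces[OF sub sub] by blast
  \<comment> \<open>\<open>P z\<close> holds the coordinates of the projection of \<open>z\<close>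
    onto the range of \<open>U\<close>, and \<open>r z\<close> is the residual.\<close>
  define P where "P z = transpose U *v z" for z
  define r where "r z = z - U *v P z" for z
  define f where "f z = V *v P z + g (r z)" for z
  have P: "(U *v x) \<bullet> z = x \<bullet> P z" for x z
    unfolding P_def by (metis dot_lmul_matrix transpose_matrix_vector transpose_transpose)
  have PU: "P (U *v x) = x" for x
    using U by (simp add: P_def Stiefel_def matrix_vector_mul_assoc)
  have "(U *v x) \<bullet> r z = 0" for x z
    unfolding r_def inner_diff_right by (simp add: P PU)
  then have rC: "r z \<in> ?C U" for z
    by (auto simp: orthogonal_def)
  show thesis
  proof
    show "f (U *v x) = V *v x" for x
      using g(1) by (simp add: f_def r_def PU linear_0)
    show "orthogonal_transformation f"
      unfolding orthogonal_transformation
    proof (intro conjI allI)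
      have P_lin: "linear P" unfolding P_def by (rule matrix_vector_mul_linear)
      then have "linear r"
        by (intro linearI)
           (simp_all add: r_def linear_add linear_scale matrix_vector_right_distrib
             matrix_vector_mult_scaleR algebra_simps)
      then have "linear (\<lambda>z. V *v P z)" "linear (\<lambda>z. g (r z))"
        using g(1) P_lin linear_compose[unfolded o_def] matrix_vector_mul_linear by blast+
      then show "linear f"
        unfolding f_def by (rule linear_compose_add)
    next
      fix z
      have "g (r z) \<in> ?C V" using rC g(2) by blast
      then have 1: "orthogonal (V *v P z) (g (r z))" by blast
      have 2: "orthogonal (U *v P z) (r z)" using rC by blast
      have nV: "norm (V *v x) = norm (U *v x)" for x
        by (simp add: norm_eq_sqrt_inner Stiefel_inner[OF U] Stiefel_inner[OF V])
      have "(norm (f z))\<^sup>2 = (norm (U *v P z + r z))\<^sup>2"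
        using norm_add_Pythagorean[OF 1] norm_add_Pythagorean[OF 2] by (simp add: f_def nV g(3)[OF rC])
      also have "U *v P z + r z = z" by (simp add: r_def)
      finally show "norm (f z) = norm z" by simp
    qed
  qed
qed

text \<open>A wrong determinant is corrected by first reflecting along a unit vector orthogonal to
  all columns of \<open>U\<close>. This leaves the range of \<open>U\<close> fixed and flips the
  sign.\<close>

lemma Stiefel_rotation_exists:
  fixes U V :: "real^'p^'n"
  assumes U: "U \<in> Stiefel" and V: "V \<in> Stiefel" and card: "CARD('p) < CARD('n)"
  obtains f where "orthogonal_transformation f" "det (matrix f) = 1" "\<And>x. f (U *v x) = V *v x"
proof -
  obtain f where f: "orthogonal_transformation f" "\<And>x. f (U *v x) = V *v x"
    by (metis Stiefel_orthogonal_transformation_exists[OF U V])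
  show thesis
  proof (cases "det (matrix f) = 1")
    case False
    then have det: "det (matrix f) = -1"
      using orthogonal_transformation_det[OF f(1)] by (auto simp: abs_if split: if_splits)
    let ?C = "{y. \<forall>x\<in>range ((*v) U). orthogonal x y}"
    have "dim ?C \<noteq> 0" using dim_Stiefel_complement[OF U] card by linarith
    then obtain y where y: "y \<in> ?C" "y \<noteq> 0"
      unfolding dim_eq_0 by blast
    define w where "w = y /\<^sub>R norm y"
    have w: "norm w = 1" using y by (simp add: w_def)
    have wU: "w \<bullet> (U *v x) = 0" for x
      using y by (auto simp: w_def orthogonal_def inner_commute)
    note rot = orthogonal_transformation_hyperplane_reflection[OF w]
    show thesis
    proof
      show "orthogonal_transformation (f \<circ> hyperplane_reflection w)"
        using f(1) rot by (rule orthogonal_transformation_compose)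
      show "det (matrix (f \<circ> hyperplane_reflection w)) = 1"
        using f(1) rot det w
        by (simp add: matrix_compose orthogonal_transformation_linear det_mul det_hyperplane_reflection)
      show "(f \<circ> hyperplane_reflection w) (U *v x) = V *v x" for x
        using f(2) wU by (simp add: hyperplane_reflection_def)
    qed
  qed (use f that in blast)
qed

section \<open>Norm, orthonormality and differentiation column by column\<close>

lemma norm_matrix_columns:
  fixes A :: "real^'p^'n"
  shows "(norm A)\<^sup>2 = (\<Sum>j\<in>UNIV. (norm (column j A))\<^sup>2)"
proof -
  have "(norm A)\<^sup>2 = (\<Sum>i\<in>UNIV. \<Sum>j\<in>UNIV. (A $ i $ j)\<^sup>2)"
    by (simp add: norm_matrix_eq_Frobenius sum_nonneg)
  also have "\<dots> = (\<Sum>j\<in>UNIV. \<Sum>i\<in>UNIV. (A $ i $ j)\<^sup>2)"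
    by (rule sum.swap)
  finally show ?thesis
    by (simp add: norm_vec_def L2_set_def sum_nonneg column_def)
qed

lemma column_diff: "column j (A - B) = column j A - column j B"
  by (simp add: column_def vec_eq_iff)

lemma Stiefel_iff_columns:
  "U \<in> Stiefel \<longleftrightarrow> (\<forall>i j. column i U \<bullet> column j U = (if i = j then 1 else 0))"
  unfolding Stiefel_def
  by (simp add: vec_eq_iff matrix_matrix_mult_def transpose_def mat_def inner_vec_def column_def)

lemma has_vector_derivative_columns:
  fixes c :: "'p::finite \<Rightarrow> real \<Rightarrow> real^'n"
  assumes "\<And>j. (c j has_vector_derivative c' j) (at t within S)"
  shows "((\<lambda>t. \<chi> i j. c j t $ i) has_vector_derivative (\<chi> i j. c' j $ i)) (at t within S)"
proof -
  \<comment> \<open>\<open>L j\<close> embeds a vector as column \<open>j\<close> of an otherwise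
    zero matrix; the curve is the sum of these bounded linear images of its columns.\<close>
  define L where "L j x = (\<chi> i k. if k = j then x $ i else 0)" for j :: 'p and x :: "real^'n"
  have "linear (L j)" for j
    by (rule linearI) (auto simp: L_def vec_eq_iff)
  then have "bounded_linear (L j)" for j
    by (simp add: linear_conv_bounded_linear)
  then have "((\<lambda>t. L j (c j t)) has_vector_derivative L j (c' j)) (at t within S)" for j
    by (rule bounded_linear.has_vector_derivative[OF _ assms])
  then have "((\<lambda>t. \<Sum>j\<in>UNIV. L j (c j t)) has_vector_derivative (\<Sum>j\<in>UNIV. L j (c' j))) (at t within S)"
    by (intro has_vector_derivative_sum) auto
  moreover have "(\<Sum>j\<in>UNIV. L j (x j)) = (\<chi> i j. x j $ i)" for x
    by (simp add: L_def vec_eq_iff)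
  ultimately show ?thesis by simp
qed

lemma continuous_on_columns:
  fixes c :: "'p::finite \<Rightarrow> 'a::topological_space \<Rightarrow> real^'n"
  assumes "\<And>j. continuous_on S (c j)"
  shows "continuous_on S (\<lambda>t. \<chi> i j. c j t $ i)"
proof -
  have "continuous_on S (\<lambda>t. c j t $ i)" for i j
    using assms by (rule continuous_on_component)
  then show ?thesis
    by (intro continuous_on_vec_lambda)
qed

section \<open>The connecting curve and its length\<close>

theorem theorem6p4:
  fixes U V :: "real ^ 'p ^ 'n"
  assumes "CARD('p) \<ge> 1" and "CARD('n) \<ge> 2 * CARD('p)"
    and "U \<in> Stiefel" and "V \<in> Stiefel"
  shows "dist_E U V \<le> ereal (pi / 2 * norm (V - U))"
proof -
  \<comment> \<open>Strict inequality leaves a direction orthogonal to the columns of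
    \<open>U\<close>, along which the determinant can be adjusted.\<close>
  have "CARD('p) < CARD('n)" using assms(1,2) by linarith
  then obtain f where f: "orthogonal_transformation f" "det (matrix f) = 1"
    and fUV: "\<And>x. f (U *v x) = V *v x"
    by (metis Stiefel_rotation_exists[OF assms(3,4)])
  have f_col: "f (column j U) = column j V" for j
    using fUV[of "axis j 1"] by (simp add: matrix_vector_mul_component matrix_vector_mult_basis)
  obtain R R' where motion: "\<And>t x. (\<forall>y. R t x \<bullet> R t y = x \<bullet> y) \<and> R 0 x = x \<and> R 1 x = f x \<and>
     ((\<lambda>s. R s x) has_vector_derivative R' t x) (at t) \<and>
     continuous_on UNIV (\<lambda>s. R' s x) \<and> norm (R' t x) \<le> pi / 2 * norm (f x - x)"
    using short_motion_UNIV[OF f] unfolding short_motion_def by blast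
  have R: "R t x \<bullet> R t y = x \<bullet> y" "R 0 x = x" "R 1 x = f x"
     "((\<lambda>s. R s x) has_vector_derivative R' t x) (at t)"
     "continuous_on UNIV (\<lambda>s. R' s x)"
     "norm (R' t x) \<le> pi / 2 * norm (f x - x)" for t x y
    using motion[of t x] by blast+
  define \<gamma> :: "real \<Rightarrow> real^'p^'n" where "\<gamma> t = (\<chi> i j. R t (column j U) $ i)" for t
  define \<gamma>' :: "real \<Rightarrow> real^'p^'n" where "\<gamma>' t = (\<chi> i j. R' t (column j U) $ i)" for t
  have col: "column j (\<gamma> t) = R t (column j U)" "column j (\<gamma>' t) = R' t (column j U)" for j t
    by (simp_all add: \<gamma>_def \<gamma>'_def column_def vec_eq_iff)
  have deriv: "(\<gamma> has_vector_derivative \<gamma>' t) (at t within {0..1})" for t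
    unfolding \<gamma>_def \<gamma>'_def
    by (rule has_vector_derivative_columns[OF has_vector_derivative_at_within[OF R(4)]])
  \<comment> \<open>Derivatives within a nondegenerate interval are unique, also at its endpoints,
    so \<open>vector_derivative\<close> returns \<open>\<gamma>'\<close>.\<close>
  have vd: "vector_derivative \<gamma> (at t within {0..1}) = \<gamma>' t" if "t \<in> {0..1}" for t
    by (rule vector_derivative_within_closed_interval[OF _ that deriv]) simp
  have cont: "continuous_on {0..1} \<gamma>'"
    unfolding \<gamma>'_def by (rule continuous_on_columns[OF continuous_on_subset[OF R(5)]]) auto
  have "C1_curve \<gamma>"
    unfolding C1_curve_def
  proof
    show "\<gamma> differentiable_on {0..1}"
      using deriv by (auto simp: differentiable_on_def intro: differentiableI_vector)
    show "continuous_on {0..1} (\<lambda>t. vector_derivative \<gamma> (at t within {0..1}))"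
      using vd by (intro continuous_on_eq[OF cont]) simp
  qed
  moreover have "\<gamma> t \<in> Stiefel" for t
    using assms(3) by (simp add: Stiefel_iff_columns col R(1))
  moreover have "\<gamma> 0 = U" "\<gamma> 1 = V"
    unfolding \<gamma>_def R(2,3) f_col by (simp_all add: column_def vec_eq_iff)
  ultimately have "\<gamma> \<in> Stiefel_curves U V"
    by (simp add: Stiefel_curves_def)
  moreover have "curve_length \<gamma> \<le> pi / 2 * norm (V - U)"
  proof -
    \<comment> \<open>The column bounds are squared and summed; both sums are squared Frobenius
      norms. The bound is uniform in \<open>t\<close>, so integrating over an interval of length 1
      preserves it.\<close>
    have "norm (\<gamma>' t) \<le> pi / 2 * norm (V - U)" for t
    proof (rule power2_le_imp_le)
      have "(norm (\<gamma>' t))\<^sup>2 \<le> (\<Sum>j\<in>UNIV. (pi / 2 * norm (column j V - column j U))\<^sup>2)"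
        unfolding norm_matrix_columns col f_col[symmetric]
        by (intro sum_mono power_mono R(6)) auto
      also have "\<dots> = (pi / 2 * norm (V - U))\<^sup>2"
        unfolding norm_matrix_columns[of "V - U"] power_mult_distrib sum_distrib_left
        by (simp add: column_diff)
      finally show "(norm (\<gamma>' t))\<^sup>2 \<le> (pi / 2 * norm (V - U))\<^sup>2" .
    qed simp
    then have "integral {0..1} (\<lambda>t. norm (\<gamma>' t)) \<le> integral {0..1::real} (\<lambda>t. pi / 2 * norm (V - U))"
      using cont by (intro integral_le integrable_continuous_real continuous_intros) auto
    also have "integral {0..1} (\<lambda>t. norm (\<gamma>' t)) = curve_length \<gamma>"
      unfolding curve_length_def using vd by (intro integral_cong) simp
    finally show ?thesis by simp
  qed
  ultimately show ?thesis
    unfolding dist_E_def by (intro INF_lower2[of \<gamma>]) auto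
qed

end
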